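(* For all $m\geq 3$ and $n\geq 4$, the graph $P_m\Box C_n$ is $2$-spanning cyclable.
   Context: $P_m$ is the path of order $m$, $C_n$ the cycle of order $n$, $\Box$ the Cartesian product. A 2-factor of a graph is a spanning subgraph in which every vertex has valency 2. A 2-factor separates a set $A$ of $k$ vertices if it consists of exactly $k$ cycles and $A$ meets the vertex set of each cycle in exactly one vertex. A graph $X$ is $k$-spanning cyclable if for every $A\subseteq V(X)$ with $|A|=k$ there is a 2-factor of $X$ separating $A$. *)

theory Defs
  imports "Graph_Theory.Graph_Theory"
begin

text \<open>
  A finite simple graph is a \<^locale>\<open>pair_graph\<close>: a finite, loop-free, symmetric digraph without
  parallel arcs.  Every edge is thus represented by its two opposite arcs, and the valency of a
  vertex is its out-degree.
\<close>

definition path_graph :: "nat \<Rightarrow> nat pair_pre_digraph" where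
  "path_graph m =
    \<lparr> pverts = {..<m},
      parcs = {(i, j). i < m \<and> j < m \<and> (j = Suc i \<or> i = Suc j)} \<rparr>"

text \<open>The following is the cycle of order \<open>n\<close> only for \<open>n \<ge> 3\<close>.\<close>

definition cycle_graph :: "nat \<Rightarrow> nat pair_pre_digraph" where
  "cycle_graph n =
    \<lparr> pverts = {..<n},
      parcs = {(i, j). i < n \<and> j < n \<and> (j = Suc i mod n \<or> i = Suc j mod n)} \<rparr>"

definition cartesian_product ::
    "'a pair_pre_digraph \<Rightarrow> 'b pair_pre_digraph \<Rightarrow> ('a \<times> 'b) pair_pre_digraph"
    (infixr \<open>\<box>\<close> 70) where
  "G \<box> H =
    \<lparr> pverts = pverts G \<times> pverts H,
      parcs = {((u, v), (u', v')).
        u = u' \<and> u \<in> pverts G \<and> (v, v') \<in> parcs H \<or>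
        v = v' \<and> v \<in> pverts H \<and> (u, u') \<in> parcs G} \<rparr>"

lemma pair_graph_path_cartesian_product_cycle:
  assumes "n \<ge> 3"
  shows "pair_graph (path_graph m \<box> cycle_graph n)"
proof -
  have *: "Suc i mod n \<noteq> i" if "i < n" for i
    using that assms by (auto simp: mod_Suc)
  then have **: "i \<noteq> Suc i mod n" if "i < n" for i
    using that by metis
  have "finite (parcs (path_graph m \<box> cycle_graph n))"
    by (rule finite_subset[of _ "({..<m} \<times> {..<n}) \<times> ({..<m} \<times> {..<n})"])
      (auto simp: cartesian_product_def path_graph_def cycle_graph_def)
  then show ?thesis
    by unfold_locales
      (auto simp: * ** cartesian_product_def path_graph_def cycle_graph_def symmetric_def intro!: symI)
qed

definition two_factor :: "'a pair_pre_digraph \<Rightarrow> 'a pair_pre_digraph \<Rightarrow> bool" where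
  "two_factor F X \<longleftrightarrow>
    pair_graph F \<and> spanning F X \<and> (\<forall>v\<in>pverts F. out_degree F v = 2)"

definition is_cycle :: "'a pair_pre_digraph \<Rightarrow> bool" where
  "is_cycle C \<longleftrightarrow> (\<exists>n\<ge>3. digraph_iso (with_proj C) (with_proj (cycle_graph n)))"

text \<open>
  \<open>F\<close> consists of the cycles in \<open>\<C>\<close> if it is their vertex-disjoint union;
  \<open>\<C>\<close> is then the set of all cycles contained in \<open>F\<close>.
\<close>

definition consists_of_cycles :: "'a pair_pre_digraph \<Rightarrow> 'a pair_pre_digraph set \<Rightarrow> bool" where
  "consists_of_cycles F \<C> \<longleftrightarrow>
    (\<forall>C\<in>\<C>. is_cycle C) \<and>
    (\<forall>C\<in>\<C>. \<forall>D\<in>\<C>. C \<noteq> D \<longrightarrow> pverts C \<inter> pverts D = {}) \<and>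
    pverts F = (\<Union>C\<in>\<C>. pverts C) \<and>
    parcs F = (\<Union>C\<in>\<C>. parcs C)"

definition separates :: "'a pair_pre_digraph \<Rightarrow> 'a set \<Rightarrow> bool" where
  "separates F A \<longleftrightarrow>
    (\<exists>\<C>. consists_of_cycles F \<C> \<and> finite \<C> \<and> card \<C> = card A \<and>
      (\<forall>C\<in>\<C>. card (A \<inter> pverts C) = 1))"

definition spanning_cyclable :: "nat \<Rightarrow> 'a pair_pre_digraph \<Rightarrow> bool" where
  "spanning_cyclable k X \<longleftrightarrow>
    (\<forall>A. A \<subseteq> pverts X \<and> finite A \<and> card A = k \<longrightarrow> (\<exists>F. two_factor F X \<and> separates F A))"

end

theory Submission
  imports Defs
begin

text \<open>
  View \<open>P\<^sub>m \<box> C\<^sub>n\<close> as \<open>m\<close> cyclic rows of length \<open>n\<close>.  Two vertices in different rows are separated by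
  cutting the rows into two bands: each band is Hamiltonian, running through columns \<open>1, \<dots>, n - 1\<close> row
  by row in alternating directions and returning along column \<open>0\<close>.

  For two vertices in the same row, rotate the columns such that the first vertex is in column
  \<open>0\<close> or \<open>1\<close> and the second one is not.  If \<open>m\<close> is even, columns \<open>0\<close> and \<open>1\<close> form a ladder bounded by
  a cycle, and the other columns have a Hamiltonian cycle, which runs through columns \<open>2, \<dots>, n - 2\<close>
  row by row and returns along column \<open>n - 1\<close>.  If \<open>m\<close> is odd, such a run would end on the wrong
  side; then the two vertices \<open>(0, 0)\<close> and \<open>(0, 1)\<close> are moved from the ladder to the second cycle,
  which now winds around the cylinder through them.  A reflection of the rows ensures that the first
  vertex still lies on the ladder.
\<close>

section \<open>From vertex lists to 2-factors\<close>

definition cycle_in :: "'a pair_pre_digraph \<Rightarrow> 'a list \<Rightarrow> bool" where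
  "cycle_in G xs \<longleftrightarrow> 3 \<le> length xs \<and> distinct xs \<and>
    successively (\<lambda>x y. (x, y) \<in> parcs G) xs \<and> (last xs, hd xs) \<in> parcs G"

text \<open>The arcs are transported from \<open>cycle_graph\<close> along the indexing map, so that
  for distinct entries indexing is itself the isomorphism required by
  \<open>is_cycle\<close>.\<close>

definition list_cycle :: "'a list \<Rightarrow> 'a pair_pre_digraph" where
  "list_cycle xs = \<lparr> pverts = set xs,
     parcs = map_prod ((!) xs) ((!) xs) ` parcs (cycle_graph (length xs)) \<rparr>"

lemma pverts_list_cycle [simp]: "pverts (list_cycle xs) = set xs"
  by (simp add: list_cycle_def)

lemma is_cycle_list_cycle:
  assumes "distinct xs" "3 \<le> length xs"
  shows "is_cycle (list_cycle xs)"
proof -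
  let ?n = "length xs"
  let ?h = "\<lparr> iso_verts = (!) xs, iso_arcs = map_prod ((!) xs) ((!) xs),
    iso_head = snd, iso_tail = fst \<rparr>"
  have wf: "wf_digraph (with_proj (cycle_graph ?n))"
    by unfold_locales (auto simp: cycle_graph_def)
  have inj: "inj_on ((!) xs) {..<?n}"
    using assms(1) by (simp add: inj_on_nth)
  have sub: "parcs (cycle_graph ?n) \<subseteq> {..<?n} \<times> {..<?n}"
    by (auto simp: cycle_graph_def)
  have "pre_digraph.digraph_isomorphism (with_proj (cycle_graph ?n)) ?h"
    unfolding pre_digraph.digraph_isomorphism_def
    using wf inj inj_on_subset[OF map_prod_inj_on[OF inj inj] sub]
    by (auto simp: cycle_graph_def)
  moreover have "with_proj (list_cycle xs) = app_iso ?h (with_proj (cycle_graph ?n))"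
    by (auto simp: app_iso_def with_proj_def list_cycle_def set_conv_nth cycle_graph_def)
  ultimately have "digraph_iso (with_proj (cycle_graph ?n)) (with_proj (list_cycle xs))"
    unfolding digraph_iso_def by blast
  then show ?thesis
    unfolding is_cycle_def using digraph_iso_swap[OF wf] assms(2) by blast
qed

lemma parcs_list_cycle:
  "parcs (list_cycle xs) =
    {(xs ! i, xs ! j) | i j. i < length xs \<and> j < length xs \<and>
      (j = Suc i mod length xs \<or> i = Suc j mod length xs)}"
  by (auto simp: list_cycle_def cycle_graph_def image_def)

text \<open>\<open>cycle_in\<close> provides only the arcs in the direction of traversal, including
  the closing one; symmetry of \<open>G\<close> provides their opposites.\<close>

lemma list_cycle_arc_in:
  assumes "cycle_in G xs" "symmetric G" "e \<in> parcs (list_cycle xs)"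
  shows "e \<in> parcs G"
proof -
  have sym: "(y, x) \<in> parcs G" if "(x, y) \<in> parcs G" for x y
    using assms(2) that by (auto simp: symmetric_def dest: symD)
  have step: "(xs ! i, xs ! (Suc i mod length xs)) \<in> parcs G" if "i < length xs" for i
  proof (cases "Suc i < length xs")
    case True
    then show ?thesis
      using assms(1) by (auto simp: cycle_in_def dest: successively_nth)
  next
    case False
    then have "Suc i = length xs" using that by simp
    moreover from this have "xs \<noteq> []" "i = length xs - 1" by auto
    ultimately show ?thesis
      using assms(1) by (auto simp: cycle_in_def last_conv_nth hd_conv_nth)
  qed
  show ?thesis
    using assms(3) step sym by (auto simp: parcs_list_cycle)
qed

lemma pair_graph_list_cycle:
  assumes "distinct xs" "3 \<le> length xs"
  shows "pair_graph (list_cycle xs)"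
proof
  have "finite ((\<lambda>(i, j). (xs ! i, xs ! j)) ` ({..<length xs} \<times> {..<length xs}))" by simp
  then show "finite (parcs (list_cycle xs))"
    by (rule finite_subset[rotated]) (auto simp: parcs_list_cycle)
  show "fst e \<noteq> snd e" if "e \<in> parcs (list_cycle xs)" for e
  proof -
    from that obtain i j where ij: "e = (xs ! i, xs ! j)" "i < length xs" "j < length xs"
      and "j = Suc i mod length xs \<or> i = Suc j mod length xs"
      by (auto simp: parcs_list_cycle)
    then have "i \<noteq> j" using assms(2) by (auto simp: mod_Suc split: if_splits)
    then show ?thesis using ij assms(1) by (simp add: nth_eq_iff_index_eq)
  qed
  show "symmetric (with_proj (list_cycle xs))"
    by (auto simp: symmetric_def parcs_list_cycle intro!: symI)
qed (auto simp: parcs_list_cycle)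

lemma out_degree_list_cycle:
  assumes "distinct xs" "3 \<le> length xs" "v \<in> set xs"
  shows "out_degree (list_cycle xs) v = 2"
proof -
  let ?n = "length xs"
  obtain i where i: "i < ?n" "v = xs ! i"
    using assms(3) by (metis in_set_conv_nth)
  \<comment> \<open>The cyclic predecessor of \<open>i\<close>. It differs from the cyclic successor
    because the length is at least 3, which makes the valency 2 rather than 1.\<close>
  define p where "p = (if i = 0 then ?n - 1 else i - 1)"
  have p: "i = Suc j mod ?n \<longleftrightarrow> j = p" if "j < ?n" for j
    using i(1) that by (auto simp: p_def mod_Suc)
  have pn: "p < ?n" "Suc i mod ?n < ?n" "p \<noteq> Suc i mod ?n"
    using i(1) assms(2) by (auto simp: p_def mod_Suc)
  have "out_arcs (list_cycle xs) v = {(xs ! i, xs ! (Suc i mod ?n)), (xs ! i, xs ! p)}"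
  proof (rule set_eqI, rule iffI)
    fix e assume "e \<in> out_arcs (list_cycle xs) v"
    then obtain k j where kj: "e = (xs ! k, xs ! j)" "xs ! k = xs ! i" "k < ?n" "j < ?n"
      and step: "j = Suc k mod ?n \<or> k = Suc j mod ?n"
      using i(2) by (auto simp: out_arcs_def parcs_list_cycle)
    then have "k = i" using assms(1) i(1) by (simp add: nth_eq_iff_index_eq)
    then show "e \<in> {(xs ! i, xs ! (Suc i mod ?n)), (xs ! i, xs ! p)}"
      using kj step p by blast
  next
    fix e assume "e \<in> {(xs ! i, xs ! (Suc i mod ?n)), (xs ! i, xs ! p)}"
    then show "e \<in> out_arcs (list_cycle xs) v"
      using i p[OF pn(1)] pn(1,2) unfolding out_arcs_def parcs_list_cycle with_proj_simps by auto
  qed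
  then show ?thesis
    using pn assms(1) by (auto simp: out_degree_def nth_eq_iff_index_eq)
qed

text \<open>The combinatorial core of the problem: once two such lists are found, their union is the
  required 2-factor.\<close>

definition separable_by_cycles :: "'a pair_pre_digraph \<Rightarrow> 'a \<Rightarrow> 'a \<Rightarrow> bool" where
  "separable_by_cycles G u v \<longleftrightarrow>
    (\<exists>xs ys. cycle_in G xs \<and> u \<in> set xs \<and> cycle_in G ys \<and> v \<in> set ys \<and>
      set xs \<inter> set ys = {} \<and> set xs \<union> set ys = pverts G)"

lemma two_factor_separating_pair:
  assumes G: "pair_graph G"
    and "separable_by_cycles G u v"
  shows "\<exists>F. two_factor F G \<and> separates F {u, v}"
proof -
  obtain xs ys where
    xs: "cycle_in G xs" "u \<in> set xs" and ys: "cycle_in G ys" "v \<in> set ys"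
    and disj: "set xs \<inter> set ys = {}" and un: "set xs \<union> set ys = pverts G"
    using assms(2) unfolding separable_by_cycles_def by blast
  let ?C = "list_cycle xs" and ?D = "list_cycle ys"
  define F where "F = \<lparr> pverts = set xs \<union> set ys, parcs = parcs ?C \<union> parcs ?D \<rparr>"
  have dx: "distinct xs" "3 \<le> length xs" and dy: "distinct ys" "3 \<le> length ys"
    using xs ys by (auto simp: cycle_in_def)
  interpret G: pair_graph G by (fact G)
  interpret C: pair_graph ?C using dx by (rule pair_graph_list_cycle)
  interpret D: pair_graph ?D using dy by (rule pair_graph_list_cycle)
  have symG: "symmetric G" by (rule G.pair_sym_arcs)
  have F: "pair_graph F"
  proof
    show "symmetric (with_proj F)"
      using C.pair_sym_arcs D.pair_sym_arcs
      by (auto simp: F_def symmetric_def intro: sym_Un)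
    show "fst e \<in> pverts F" "snd e \<in> pverts F" if "e \<in> parcs F" for e
      using that C.arc_fst_in_verts[of e] C.arc_snd_in_verts[of e]
        D.arc_fst_in_verts[of e] D.arc_snd_in_verts[of e]
      by (auto simp: F_def)
    show "fst e \<noteq> snd e" if "e \<in> parcs F" for e
      using that C.pair_no_loops[of e] D.pair_no_loops[of e] by (auto simp: F_def)
    show "finite (pverts F)" "finite (parcs F)"
      using C.pair_finite_arcs D.pair_finite_arcs by (auto simp: F_def)
  qed
  interpret F: pair_graph F by (fact F)
  have span: "spanning F G"
    unfolding spanning_def subgraph_def
    using un list_cycle_arc_in[OF xs(1) symG] list_cycle_arc_in[OF ys(1) symG]
      G.wf_digraph_axioms F.wf_digraph_axioms
    by (auto simp: F_def)
  \<comment> \<open>By disjointness a vertex of one cycle is not the tail of any arc of the other,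
    so valencies in \<open>F\<close> are those in the separate cycles.\<close>
  have "out_arcs F w = out_arcs ?C w" if "w \<in> set xs" for w
    using that disj by (auto simp: F_def out_arcs_def disjoint_iff dest: D.in_arcsD1)
  moreover have "out_arcs F w = out_arcs ?D w" if "w \<in> set ys" for w
    using that disj by (auto simp: F_def out_arcs_def disjoint_iff dest: C.in_arcsD1)
  ultimately have deg: "\<forall>w\<in>pverts F. out_degree F w = 2"
    using out_degree_list_cycle[OF dx] out_degree_list_cycle[OF dy]
    by (auto simp: F_def out_degree_def)
  have "consists_of_cycles F {?C, ?D}"
    using disj is_cycle_list_cycle[OF dx] is_cycle_list_cycle[OF dy]
    by (auto simp: consists_of_cycles_def F_def)
  \<comment> \<open>Both inequalities enter the count: two cycles for a set of two vertices.\<close>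
  moreover have "u \<noteq> v" "?C \<noteq> ?D"
    using xs(2) ys(2) disj by (auto dest: arg_cong[of _ _ pverts])
  moreover have "{u, v} \<inter> set xs = {u}" "{u, v} \<inter> set ys = {v}"
    using xs(2) ys(2) disj by auto
  ultimately have "separates F {u, v}"
    unfolding separates_def by (intro exI[of _ "{?C, ?D}"]) simp
  with F span deg show ?thesis
    unfolding two_factor_def by blast
qed

section \<open>Invariance of separability\<close>

lemma separable_by_cycles_commute:
  "separable_by_cycles G u v \<Longrightarrow> separable_by_cycles G v u"
  unfolding separable_by_cycles_def by (metis inf_commute sup_commute)

lemma cycle_in_map:
  assumes "cycle_in G xs" "inj_on f (set xs)"
    and arcs: "\<And>x y. (x, y) \<in> parcs G \<Longrightarrow> (f x, f y) \<in> parcs G"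
  shows "cycle_in G (map f xs)"
proof -
  have "xs \<noteq> []" using assms(1) by (auto simp: cycle_in_def)
  moreover from this have "successively (\<lambda>x y. (f x, f y) \<in> parcs G) xs"
    using assms(1) by (auto simp: cycle_in_def intro: successively_mono arcs)
  ultimately show ?thesis
    using assms by (auto simp: cycle_in_def distinct_map successively_map last_map hd_map)
qed

lemma separable_by_cycles_automorphism:
  assumes "separable_by_cycles G u v" "bij_betw f (pverts G) (pverts G)"
    and "\<And>x y. (x, y) \<in> parcs G \<Longrightarrow> (f x, f y) \<in> parcs G"
  shows "separable_by_cycles G (f u) (f v)"
proof -
  obtain xs ys where
    xs: "cycle_in G xs" "u \<in> set xs" and ys: "cycle_in G ys" "v \<in> set ys"
    and disj: "set xs \<inter> set ys = {}" and un: "set xs \<union> set ys = pverts G"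
    using assms(1) unfolding separable_by_cycles_def by blast
  have inj: "inj_on f (set xs \<union> set ys)"
    using assms(2) un by (simp add: bij_betw_def)
  then have "cycle_in G (map f xs)" "cycle_in G (map f ys)"
    using xs(1) ys(1) assms(3) by (auto intro!: cycle_in_map simp: inj_on_Un)
  moreover have "set (map f xs) \<inter> set (map f ys) = {}"
    using inj_on_image_Int[OF inj, of "set xs" "set ys"] disj by simp
  moreover have "set (map f xs) \<union> set (map f ys) = pverts G"
    using assms(2) un by (simp add: bij_betw_def flip: image_Un)
  ultimately show ?thesis
    unfolding separable_by_cycles_def using xs(2) ys(2)
    by (intro exI[of _ "map f xs"] exI[of _ "map f ys"]) simp
qed

section \<open>Snakes on the cylinder\<close>

abbreviation cylinder :: "nat \<Rightarrow> nat \<Rightarrow> (nat \<times> nat) pair_pre_digraph" where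
  "cylinder m n \<equiv> path_graph m \<box> cycle_graph n"

lemma pverts_cylinder: "pverts (cylinder m n) = {..<m} \<times> {..<n}"
  by (simp add: cartesian_product_def path_graph_def cycle_graph_def)

lemma arc_cylinder_iff:
  "((i, j), (i', j')) \<in> parcs (cylinder m n) \<longleftrightarrow>
    i < m \<and> i' < m \<and> j < n \<and> j' < n \<and>
    (i = i' \<and> (j' = Suc j mod n \<or> j = Suc j' mod n) \<or> j = j' \<and> (i' = Suc i \<or> i = Suc i'))"
  by (auto simp: cartesian_product_def path_graph_def cycle_graph_def)

lemma successively_upt:
  "successively P [a..<b] \<longleftrightarrow> (\<forall>i. a \<le> i \<longrightarrow> Suc i < b \<longrightarrow> P i (Suc i))"
  by (auto simp: successively_conv_nth) (metis add.commute add_Suc_right le_Suc_ex less_diff_conv)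

text \<open>
  The rows \<open>l, \<dots>, l + k - 1\<close> restricted to columns \<open>p, \<dots>, q - 1\<close>, traversed in alternating
  directions; \<open>b\<close> tells whether the first row is traversed from left to right.
\<close>
fun snake :: "bool \<Rightarrow> nat \<Rightarrow> nat \<Rightarrow> nat \<Rightarrow> nat \<Rightarrow> (nat \<times> nat) list" where
  "snake b p q l 0 = []"
| "snake b p q l (Suc k) =
    map (Pair l) (if b then [p..<q] else rev [p..<q]) @ snake (\<not> b) p q (Suc l) k"

lemma set_snake: "set (snake b p q l k) = {l..<l + k} \<times> {p..<q}"
  by (induction b p q l k rule: snake.induct) auto

lemma distinct_snake: "distinct (snake b p q l k)"
  by (induction b p q l k rule: snake.induct) (auto simp: distinct_map inj_on_def set_snake)

lemma snake_eq_Nil_iff: "p < q \<Longrightarrow> snake b p q l k = [] \<longleftrightarrow> k = 0"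
  by (cases k) auto

lemma hd_snake:
  assumes "p < q" "0 < k"
  shows "hd (snake b p q l k) = (l, if b then p else q - 1)"
  using assms by (cases k) (auto simp: hd_append hd_map hd_rev last_map)

text \<open>The direction flips \<open>k - 1\<close> times, so the last row runs from left to right
  exactly if \<open>b = odd k\<close>.\<close>

lemma last_snake:
  assumes "p < q" "0 < k"
  shows "last (snake b p q l k) = (l + k - 1, if b = odd k then q - 1 else p)"
  using assms
proof (induction b p q l k rule: snake.induct)
  case (2 b p q l k)
  then show ?case
    by (cases "k = 0") (auto simp: snake_eq_Nil_iff last_append last_map last_rev hd_map)
qed simp

text \<open>Alternation makes each row start in the column where the previous one ended, so the turn
  is a vertical arc.\<close>

lemma successively_snake:
  assumes "p < q" "q \<le> n" "l + k \<le> m"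
  shows "successively (\<lambda>x y. (x, y) \<in> parcs (cylinder m n)) (snake b p q l k)"
  using assms
proof (induction b p q l k rule: snake.induct)
  case (2 b p q l k)
  then show ?case
    by (cases "k = 0")
      (auto simp: successively_append_iff successively_map successively_upt arc_cylinder_iff
        hd_snake hd_map last_map last_rev)
qed simp

section \<open>Different rows\<close>

text \<open>The snake ends in column 1 or \<open>n - 1\<close> depending on the parity of
  \<open>k\<close>; both are adjacent to column 0, the latter around the cylinder, so the return
  path always fits.\<close>

lemma cycle_in_band:
  assumes "3 \<le> n" "0 < k" "l + k \<le> m"
  shows "cycle_in (cylinder m n) (snake True 1 n l k @ map (\<lambda>i. (i, 0)) (rev [l..<l + k]))"
    (is "cycle_in _ (?S @ ?R)")
proof -
  have "?S \<noteq> []" "?R \<noteq> []" using assms by (auto simp: snake_eq_Nil_iff)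
  moreover have "distinct (?S @ ?R)"
    using distinct_snake by (auto simp: distinct_map inj_on_def set_snake)
  moreover from this have "3 \<le> length (?S @ ?R)"
  proof -
    \<comment> \<open>A band may be a single row, so the length bound comes from the
      \<open>n\<close> vertices of row \<open>l\<close>.\<close>
    have "card ({l} \<times> {..<n}) \<le> card (set (?S @ ?R))"
      using assms by (intro card_mono) (auto simp: set_snake image_iff)
    then show ?thesis
      using assms(1) distinct_card[OF \<open>distinct (?S @ ?R)\<close>] by simp
  qed
  moreover have "successively (\<lambda>x y. (x, y) \<in> parcs (cylinder m n)) ?S"
    using assms by (intro successively_snake) auto
  moreover have "successively (\<lambda>x y. (x, y) \<in> parcs (cylinder m n)) ?R"
    using assms by (auto simp: successively_map successively_upt arc_cylinder_iff)
  ultimately show ?thesis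
    using assms unfolding cycle_in_def
    by (auto simp: successively_append_iff arc_cylinder_iff hd_snake last_snake
       hd_append hd_map last_map hd_rev last_rev mod_Suc)
qed

lemma separable_distinct_rows:
  assumes "3 \<le> n" "i < i'" "i' < m" "j < n" "j' < n"
  shows "separable_by_cycles (cylinder m n) (i, j) (i', j')"
proof -
  define band where
    "band l k = snake True 1 n l k @ map (\<lambda>i. (i, 0)) (rev [l..<l + k])" for l k
  have "set (band l k) = {l..<l + k} \<times> {..<n}" for l k
    using assms(1) by (auto simp: band_def set_snake image_iff)
  moreover have "cycle_in (cylinder m n) (band 0 (Suc i))"
    "cycle_in (cylinder m n) (band (Suc i) (m - Suc i))"
    using assms unfolding band_def by (intro cycle_in_band; simp)+
  ultimately show ?thesis
    unfolding separable_by_cycles_def using assms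
    by (intro exI[of _ "band 0 (Suc i)"] exI[of _ "band (Suc i) (m - Suc i)"])
      (auto simp: pverts_cylinder)
qed

section \<open>The ladder and its complement\<close>

lemma cycle_in_ladder:
  assumes "3 \<le> n" "Suc s < m"
  shows "cycle_in (cylinder m n)
    (map (\<lambda>i. (i, 0)) [s..<m] @ map (\<lambda>i. (i, 1)) (rev [s..<m]))"
proof -
  have "[s..<m] \<noteq> []" "hd [s..<m] = s" "last [s..<m] = m - 1" using assms by auto
  then show ?thesis
  using assms unfolding cycle_in_def
  by (auto simp: distinct_map inj_on_def successively_append_iff successively_map successively_upt
      arc_cylinder_iff hd_append hd_map last_map hd_rev last_rev simp del: upt_Suc)
qed

text \<open>The initial direction \<open>odd m\<close> makes the last row run from left to right, so
  the snake ends next to the return column \<open>n - 1\<close>. For even \<open>m\<close> it starts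
  at \<open>(0, n - 2)\<close>, next to the end \<open>(0, n - 1)\<close> of the return; for odd
  \<open>m\<close> it starts at \<open>(0, 2)\<close>, reached from there around the cylinder
  through \<open>(0, 0)\<close> and \<open>(0, 1)\<close>.\<close>

lemma cycle_in_ladder_complement:
  assumes "4 \<le> n" "2 \<le> m"
  shows "cycle_in (cylinder m n)
    ((if odd m then [(0, 0), (0, 1)] else []) @
      snake (odd m) 2 (n - 1) 0 m @ map (\<lambda>i. (i, n - 1)) (rev [0..<m]))"
proof -
  define P where "P = (if odd m then [(0, 0), (0, 1)] else [] :: (nat \<times> nat) list)"
  define S where "S = snake (odd m) 2 (n - 1) 0 m"
  define R where "R = map (\<lambda>i. (i, n - 1)) (rev [0..<m])"
  have ne: "S \<noteq> []" "R \<noteq> []"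
    using assms by (auto simp: S_def R_def snake_eq_Nil_iff)
  have "distinct (P @ S @ R)"
    using assms distinct_snake
    by (auto simp: P_def S_def R_def distinct_map inj_on_def set_snake)
  moreover have "3 \<le> length (P @ S @ R)"
  proof -
    have "0 < length S" "2 \<le> length R" using ne assms by (auto simp: R_def)
    then show ?thesis unfolding length_append by linarith
  qed
  moreover have "successively (\<lambda>x y. (x, y) \<in> parcs (cylinder m n)) S"
    unfolding S_def using assms by (intro successively_snake) auto
  moreover have "successively (\<lambda>x y. (x, y) \<in> parcs (cylinder m n)) R"
    using assms by (auto simp: R_def successively_map successively_upt arc_cylinder_iff)
  moreover have "hd S = (0, if odd m then 2 else n - 2)" "last S = (m - 1, n - 2)"
    "hd R = (m - 1, n - 1)" "last R = (0, n - 1)"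
    using assms
    by (auto simp: S_def R_def hd_snake last_snake hd_map last_map hd_rev last_rev)
  moreover have "((m - 1, n - 2), (m - 1, n - 1)) \<in> parcs (cylinder m n)"
    "((0, n - 1), (0, n - 2)) \<in> parcs (cylinder m n)"
    "((0, n - 1), (0, 0)) \<in> parcs (cylinder m n)"
    "((0, 0), (0, 1)) \<in> parcs (cylinder m n)"
    "((0, 1), (0, 2)) \<in> parcs (cylinder m n)"
    using assms by (auto simp: arc_cylinder_iff)
  ultimately have "cycle_in (cylinder m n) (P @ S @ R)"
    using ne unfolding cycle_in_def
    by (cases "odd m") (simp_all add: P_def successively_append_iff successively_Cons hd_append)
  then show ?thesis by (simp only: P_def S_def R_def)
qed

text \<open>The bound \<open>m mod 2 \<le> i\<close> keeps the first vertex on the ladder, which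
  loses row 0 if \<open>m\<close> is odd.\<close>

lemma separable_ladder:
  assumes "4 \<le> n" "2 \<le> m" "m mod 2 \<le> i" "i < m" "j < 2" "i' < m" "2 \<le> j'" "j' < n"
  shows "separable_by_cycles (cylinder m n) (i, j) (i', j')"
proof -
  define s where "s = m mod 2"
  define xs where "xs = map (\<lambda>i. (i, 0)) [s..<m] @ map (\<lambda>i. (i, 1 :: nat)) (rev [s..<m])"
  define ys where "ys = (if odd m then [(0, 0), (0, 1)] else []) @
      snake (odd m) 2 (n - 1) 0 m @ map (\<lambda>i. (i, n - 1)) (rev [0..<m])"
  have s: "Suc s < m" "s = (if odd m then 1 else 0)"
    unfolding s_def using assms(2) by presburger+
  have two: "{..<2} = {0, 1 :: nat}" by auto
  have xs: "set xs = {s..<m} \<times> {..<2}"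
    unfolding two by (auto simp: xs_def)
  have "{2..<n} = insert (n - 1) {2..<n - 1}"
    using assms(1) by auto
  then have ys: "set ys = {..<m} \<times> {2..<n} \<union> {..<s} \<times> {..<2}"
    unfolding two s(2) by (auto simp: ys_def set_snake)
  have "cycle_in (cylinder m n) xs" "cycle_in (cylinder m n) ys"
    unfolding xs_def ys_def using assms s(1)
    by (intro cycle_in_ladder cycle_in_ladder_complement; simp)+
  moreover have "i \<in> {s..<m}" using assms(3,4) by (simp add: s_def)
  then have "(i, j) \<in> set xs" and "(i', j') \<in> set ys"
    unfolding xs ys using assms(5-) by auto
  moreover have "set xs \<inter> set ys = {}"
    unfolding xs ys by auto
  moreover have "set xs \<union> set ys = pverts (cylinder m n)"
    unfolding xs ys pverts_cylinder using assms(1) s(1) by auto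
  ultimately show ?thesis
    unfolding separable_by_cycles_def by blast
qed

section \<open>Symmetries of the cylinder and vertices in the same row\<close>

lemma separable_reflection:
  assumes "separable_by_cycles (cylinder m n) (i, j) (i', j')"
  shows "separable_by_cycles (cylinder m n) (m - 1 - i, j) (m - 1 - i', j')"
proof -
  let ?f = "\<lambda>(i, j). (m - 1 - i, j :: nat)"
  have "bij_betw ?f (pverts (cylinder m n)) (pverts (cylinder m n))"
    by (rule bij_betw_byWitness[where f' = ?f]) (auto simp: pverts_cylinder)
  moreover have "(?f x, ?f y) \<in> parcs (cylinder m n)" if "(x, y) \<in> parcs (cylinder m n)" for x y
    using that by (cases x; cases y) (auto simp: arc_cylinder_iff)
  ultimately have "separable_by_cycles (cylinder m n) (?f (i, j)) (?f (i', j'))"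
    using assms by (blast intro: separable_by_cycles_automorphism)
  then show ?thesis by simp
qed

lemma separable_rotation:
  assumes "separable_by_cycles (cylinder m n) (i, j) (i', j')"
  shows "separable_by_cycles (cylinder m n) (i, (j + c) mod n) (i', (j' + c) mod n)"
proof (induction c)
  case 0
  have "j < n" "j' < n"
    using assms by (auto simp: separable_by_cycles_def pverts_cylinder)
  then show ?case using assms by simp
next
  case (Suc c)
  \<comment> \<open>Rotation by one column and its inverse; the inverse sends column 0 to
    \<open>n - 1\<close>.\<close>
  let ?f = "\<lambda>(i :: nat, j). (i, Suc j mod n)" and ?g = "\<lambda>(i :: nat, j). (i, if j = 0 then n - 1 else j - 1)"
  have "bij_betw ?f (pverts (cylinder m n)) (pverts (cylinder m n))"
    by (rule bij_betw_byWitness[where f' = ?g]) (auto simp: pverts_cylinder mod_Suc)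
  moreover have "(?f x, ?f y) \<in> parcs (cylinder m n)" if "(x, y) \<in> parcs (cylinder m n)" for x y
    using that by (cases x; cases y) (auto simp: arc_cylinder_iff)
  ultimately have "separable_by_cycles (cylinder m n)
      (?f (i, (j + c) mod n)) (?f (i', (j' + c) mod n))"
    using Suc.IH by (blast intro: separable_by_cycles_automorphism)
  then show ?case by (simp add: mod_simps)
qed

lemma separable_same_row:
  assumes "4 \<le> n" "2 \<le> m" "i < m" "j < n" "j' < n" "j \<noteq> j'"
  shows "separable_by_cycles (cylinder m n) (i, j) (i, j')"
proof -
  have ladder: "separable_by_cycles (cylinder m n) (i, e) (i, e')"
    if e: "e < 2" "2 \<le> e'" "e' < n" for e e'
  proof (cases "m mod 2 \<le> i")
    case True
    then show ?thesis using assms e by (intro separable_ladder) auto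
  next
    case False
    \<comment> \<open>Here \<open>m\<close> is odd and the vertices lie in row 0; reflection moves
      them to row \<open>m - 1\<close>, which meets the ladder.\<close>
    then have "i = 0" by (cases i) auto
    have "m mod 2 \<le> m - 1" using assms(2) by (cases "m = 2") auto
    then have "separable_by_cycles (cylinder m n) (m - 1, e) (m - 1, e')"
      using assms e by (intro separable_ladder) auto
    from separable_reflection[OF this] show ?thesis using \<open>i = 0\<close> by simp
  qed
  have "\<exists>c e e'. e < 2 \<and> 2 \<le> e' \<and> e' < n \<and> j = (e + c) mod n \<and> j' = (e' + c) mod n"
  proof (cases "j' = Suc j mod n")
    case True
    \<comment> \<open>If \<open>j'\<close> follows \<open>j\<close> cyclically, \<open>j\<close>
      must go to column 1 so that \<open>j'\<close> falls off the ladder, into column 2. The shift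
      is \<open>j - 1\<close> modulo \<open>n\<close>, with \<open>n\<close> added to avoid
      truncation at \<open>j = 0\<close>.\<close>
    have "j = (1 + (j + n - 1)) mod n" "j' = (2 + (j + n - 1)) mod n"
      using True assms by (auto simp: mod_Suc)
    then show ?thesis using assms(1) by (intro exI[of _ "j + n - 1"] exI[of _ 1] exI[of _ 2]) auto
  next
    case False
    \<comment> \<open>The cyclic distance from \<open>j\<close> to \<open>j'\<close>. With
      \<open>j\<close> sent to column 0, \<open>j'\<close> goes to column \<open>e'\<close>, which
      is neither 0 nor 1.\<close>
    define e' where "e' = (if j \<le> j' then j' - j else j' + n - j)"
    have *: "j' = (e' + j) mod n" "e' < n" "e' \<noteq> 0"
      using assms by (auto simp: e'_def)
    moreover from * have "e' \<noteq> 1" using False by auto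
    ultimately show ?thesis
      using assms by (intro exI[of _ j] exI[of _ 0] exI[of _ e']) auto
  qed
  then show ?thesis using ladder separable_rotation by blast
qed

theorem theorem3p4:
  fixes m n :: nat
  assumes "m \<ge> 3" and "n \<ge> 4"
  shows "spanning_cyclable 2 (path_graph m \<box> cycle_graph n)"
  unfolding spanning_cyclable_def
proof (intro allI impI)
  fix A assume A: "A \<subseteq> pverts (cylinder m n) \<and> finite A \<and> card A = 2"
  then obtain i j i' j' where eq: "A = {(i, j), (i', j')}" and ne: "(i, j) \<noteq> (i', j')"
    by (metis card_2_iff surj_pair)
  have lt: "i < m" "i' < m" "j < n" "j' < n"
    using A eq by (auto simp: pverts_cylinder)
  have "separable_by_cycles (cylinder m n) (i, j) (i', j')"
  proof (cases i i' rule: linorder_cases)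
    case less
    then show ?thesis using lt assms by (intro separable_distinct_rows) auto
  next
    case equal
    then show ?thesis using lt ne assms by (auto intro: separable_same_row)
  next
    case greater
    then show ?thesis using lt assms
      by (intro separable_by_cycles_commute[OF separable_distinct_rows]) auto
  qed
  then show "\<exists>F. two_factor F (cylinder m n) \<and> separates F A"
    using two_factor_separating_pair[OF pair_graph_path_cartesian_product_cycle] assms(2) eq
    by simp
qed

end
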